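(* Let $a>0$ and $b>0$, and put $E(x)=e^{-ax^{2}-bx}$, $W(x)=\sqrt\pi\,e^{\frac{b^{2}}{4a}}\operatorname{erf}\left(\frac{2ax+b}{2\sqrt a}\right)$ and $P(x)=\frac{105}{b^{4}x^{4}}+\frac{105}{b^{3}x^{3}}+\frac{45}{b^{2}x^{2}}+\frac{10}{bx}+1$. For $p\in\{2,0,-2,-4\}$, on $(0,\infty)$, $$\sqrt{\tfrac{2}{\pi}}\int e^{-ax^{2}}b^{4+\frac12}x^{p+\frac12}K_{\frac92}(bx)\,dx=b^{4}\int x^{p}P(x)E(x)\,dx=V_p(x),$$ where $$V_{2}(x)=-E(x)\left(\frac{20ab^{3}-b^{5}}{4a^{2}}+\frac{b^{4}x}{2a}+\frac{105}{x}\right)-\frac{(840a^{3}-180a^{2}b^{2}+18ab^{4}-b^{6})W(x)}{8a^{5/2}},$$ $$V_{0}(x)=-E(x)\left(\frac{5(2b^{2}-14a)}{x}+\frac{35b}{x^{2}}+\frac{35}{x^{3}}\right)+\frac{(140a^{2}-20ab^{2}+b^{4})W(x)}{2\sqrt a},$$ $$V_{-2}(x)=E(x)\left(\frac{2ab^{2}-28a^{2}}{x}+\frac{14ab-b^{3}}{x^{2}}+\frac{14a-8b^{2}}{x^{3}}-\frac{21b}{x^{4}}-\frac{21}{x^{5}}\right)-2a^{3/2}(14a-b^{2})W(x),$$ $$V_{-4}(x)=E(x)\left(-\frac{15}{x^{7}}-\frac{15b}{x^{6}}-\frac{6(b^{2}-a)}{x^{5}}+\frac{6ab-b^{3}}{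x^{4}}+\frac{2(ab^{2}-2a^{2})}{x^{3}}-\frac{4a^{2}b}{x^{2}}+\frac{8a^{3}}{x}\right)+8a^{7/2}W(x).$$
   Context: $K_\mu$ is the Macdonald function (modified Bessel function of the second kind); $\operatorname{erf}(z)=\frac{2}{\sqrt\pi}\int_0^z e^{-t^2}dt$. An identity $\int f\,dx=\int g\,dx=F$ means that $f=g$ on $(0,\infty)$ and that $F$ is an antiderivative of this function on $(0,\infty)$. *)

theory Defs
  imports "HOL-Analysis.Analysis"
begin

text \<open>
  Modified Bessel functions of real order, at positive real argument.
  The reciprocal Gamma function makes the terms at the poles of Gamma vanish, as usual.
\<close>

definition bessel_I :: "real \<Rightarrow> real \<Rightarrow> real" where
  "bessel_I \<nu> x = (\<Sum>k. (x / 2) powr (\<nu> + 2 * real k) * rGamma (\<nu> + real k + 1) / fact k)"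

text \<open>At integer orders the quotient is 0/0, and the function is defined by the limit in the order.\<close>

definition macdonald_K :: "real \<Rightarrow> real \<Rightarrow> real" where
  "macdonald_K \<mu> x =
     (let q = (\<lambda>\<nu>. pi / 2 * ((bessel_I (-\<nu>) x - bessel_I \<nu> x) / sin (\<nu> * pi)))
      in if \<mu> \<in> \<int> then Lim (at \<mu>) q else q \<mu>)"

text \<open>The interval integral is oriented, so this is also right for negative arguments.\<close>

definition erf :: "real \<Rightarrow> real" where
  "erf z = 2 / sqrt pi * (LBINT t=0..z. exp (- (t\<^sup>2)))"

definition E_fun :: "real \<Rightarrow> real \<Rightarrow> real \<Rightarrow> real" where
  "E_fun a b x = exp (- a * x\<^sup>2 - b * x)"

definition W_fun :: "real \<Rightarrow> real \<Rightarrow> real \<Rightarrow> real" where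
  "W_fun a b x = sqrt pi * exp (b\<^sup>2 / (4 * a)) * erf ((2 * a * x + b) / (2 * sqrt a))"

definition P_fun :: "real \<Rightarrow> real \<Rightarrow> real" where
  "P_fun b x = 105 / (b^4 * x^4) + 105 / (b^3 * x^3) + 45 / (b^2 * x^2) + 10 / (b * x) + 1"

definition V_2 :: "real \<Rightarrow> real \<Rightarrow> real \<Rightarrow> real" where
  "V_2 a b x =
     - E_fun a b x * ((20 * a * b^3 - b^5) / (4 * a^2) + b^4 * x / (2 * a) + 105 / x)
     - (840 * a^3 - 180 * a^2 * b^2 + 18 * a * b^4 - b^6) * W_fun a b x / (8 * a powr (5 / 2))"

definition V_0 :: "real \<Rightarrow> real \<Rightarrow> real \<Rightarrow> real" where
  "V_0 a b x =
     - E_fun a b x * (5 * (2 * b^2 - 14 * a) / x + 35 * b / x^2 + 35 / x^3)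
     + (140 * a^2 - 20 * a * b^2 + b^4) * W_fun a b x / (2 * sqrt a)"

definition V_minus2 :: "real \<Rightarrow> real \<Rightarrow> real \<Rightarrow> real" where
  "V_minus2 a b x =
     E_fun a b x * ((2 * a * b^2 - 28 * a^2) / x + (14 * a * b - b^3) / x^2
       + (14 * a - 8 * b^2) / x^3 - 21 * b / x^4 - 21 / x^5)
     - 2 * a powr (3 / 2) * (14 * a - b^2) * W_fun a b x"

definition V_minus4 :: "real \<Rightarrow> real \<Rightarrow> real \<Rightarrow> real" where
  "V_minus4 a b x =
     E_fun a b x * (- 15 / x^7 - 15 * b / x^6 - 6 * (b^2 - a) / x^5 + (6 * a * b - b^3) / x^4
       + 2 * (a * b^2 - 2 * a^2) / x^3 - 4 * a^2 * b / x^2 + 8 * a^3 / x)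
     + 8 * a powr (7 / 2) * W_fun a b x"

text \<open>The meaning of an identity $\int f\,dx = \int g\,dx = F$ on the positive half-line.\<close>

definition integral_identity :: "(real \<Rightarrow> real) \<Rightarrow> (real \<Rightarrow> real) \<Rightarrow> (real \<Rightarrow> real) \<Rightarrow> bool" where
  "integral_identity f g F \<longleftrightarrow>
     (\<forall>x>0. f x = g x) \<and> (\<forall>x>0. (F has_real_derivative f x) (at x))"

end

theory Submission
  imports Defs
begin

text \<open>
  The entire function $G(w) = e^w (105 - 105 w + 45 w^2 - 10 w^3 + w^4)$ has the power series
  $\sum_n (n-1)(n-3)(n-5)(n-7) w^n / n!$. The duplication formula for Gamma shows that, up to the
  common factor $\sqrt{2/\pi}\, z^{-9/2}$, the series of $I_{-9/2}(z)$ is the even part of $G$ and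
  that of $I_{9/2}(z)$ is its odd part: the odd coefficients with $n < 9$ vanish. Their
  difference leaves $G(-z)$, the closed form of $K_{9/2}$. The antiderivatives are then checked by
  differentiation, using $W' = 2 \sqrt a\, E$.
\<close>

section \<open>Power series of the entire function G\<close>

text \<open>Multiplication by w shifts the index, and w^(n+1)/n! = (n+1) w^(n+1)/(n+1)!. Iterated
  from the series of exp, this produces the falling factorials n(n-1)...(n-j+1) as coefficients of
  w^j exp w.\<close>

lemma sums_mult_index_exp_series:
  fixes h :: "real \<Rightarrow> real"
  assumes "(\<lambda>n. h (real n) * (w ^ n / fact n)) sums s"
  shows "(\<lambda>n. real n * h (real n - 1) * (w ^ n / fact n)) sums (w * s)"
proof (rule sums_Suc_imp)
  have *: "w * (h (real n) * (w ^ n / fact n))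
      = real (Suc n) * h (real (Suc n) - 1) * (w ^ Suc n / fact (Suc n))" for n
    by (simp add: divide_simps)
  from sums_mult[OF assms, of w]
  show "(\<lambda>n. real (Suc n) * h (real (Suc n) - 1) * (w ^ Suc n / fact (Suc n))) sums (w * s)"
    unfolding * .
qed simp

text \<open>The polynomial factor is the reverse Bessel polynomial of degree 4 taken at -w.\<close>

definition bessel_exp :: "real \<Rightarrow> real" where
  "bessel_exp w = exp w * (105 - 105 * w + 45 * w^2 - 10 * w^3 + w^4)"

definition bessel_coeff :: "nat \<Rightarrow> real" where
  "bessel_coeff n = (real n - 1) * (real n - 3) * (real n - 5) * (real n - 7) / fact n"

text \<open>The numbers 105, -105, 45, -10, 1 are the coefficients of (n-1)(n-3)(n-5)(n-7) in the
  basis of falling factorials of n.\<close>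

lemma bessel_exp_sums: "(\<lambda>n. bessel_coeff n * w ^ n) sums bessel_exp w"
proof -
  have 0: "(\<lambda>n. 1 * (w ^ n / fact n)) sums exp w"
    using exp_converges[of w] by (simp add: field_simps)
  note 1 = sums_mult_index_exp_series[OF 0]
  note 2 = sums_mult_index_exp_series[OF 1]
  note 3 = sums_mult_index_exp_series[OF 2]
  note 4 = sums_mult_index_exp_series[OF 3]
  from sums_add[OF sums_add[OF sums_add[OF sums_add[OF sums_mult[OF 0, of 105]
    sums_mult[OF 1, of "-105"]] sums_mult[OF 2, of 45]] sums_mult[OF 3, of "-10"]] 4]
  have "(\<lambda>n. 105 * (1 * (w ^ n / fact n)) + - 105 * (real n * 1 * (w ^ n / fact n)) +
      45 * (real n * ((real n - 1) * 1) * (w ^ n / fact n)) +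
      - 10 * (real n * ((real n - 1) * ((real n - 1 - 1) * 1)) * (w ^ n / fact n)) +
      real n * ((real n - 1) * ((real n - 1 - 1) * ((real n - 1 - 1 - 1) * 1))) * (w ^ n / fact n))
    sums (105 * exp w + - 105 * (w * exp w) + 45 * (w * (w * exp w)) +
      - 10 * (w * (w * (w * exp w))) + w * (w * (w * (w * exp w))))" .
  moreover have "105 * exp w + - 105 * (w * exp w) + 45 * (w * (w * exp w)) +
      - 10 * (w * (w * (w * exp w))) + w * (w * (w * (w * exp w))) = bessel_exp w"
    unfolding bessel_exp_def by algebra
  moreover have "105 * (1 * (w ^ n / fact n)) + - 105 * (real n * 1 * (w ^ n / fact n)) +
      45 * (real n * ((real n - 1) * 1) * (w ^ n / fact n)) +
      - 10 * (real n * ((real n - 1) * ((real n - 1 - 1) * 1)) * (w ^ n / fact n)) +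
      real n * ((real n - 1) * ((real n - 1 - 1) * ((real n - 1 - 1 - 1) * 1))) * (w ^ n / fact n)
      = bessel_coeff n * w ^ n" for n
    unfolding bessel_coeff_def by (simp add: field_simps)
  ultimately show ?thesis
    by simp
qed

section \<open>Gamma at half-integers and the Bessel functions I of orders -9/2 and 9/2\<close>

lemma rGamma_nat_plus_half: "rGamma (real m + 1/2) = 4 ^ m * fact m / (sqrt pi * fact (2 * m))"
proof -
  have "rGamma (1/2 :: real) = pochhammer (1/2) m * rGamma (1/2 + real m)"
    by (rule pochhammer_rGamma)
  moreover have "rGamma (1/2 :: real) = 1 / sqrt pi"
    by (simp add: rGamma_inverse_Gamma Gamma_one_half_real field_simps)
  moreover have "fact (2 * m) = (4 ^ m * pochhammer (1/2) m * fact m :: real)"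
    by (simp add: fact_double power_mult)
  moreover have "pochhammer (1/2 :: real) m > 0"
    by (rule pochhammer_pos) simp
  ultimately show ?thesis
    by (simp add: field_simps)
qed

text \<open>Four steps of the recurrence move the argument, negative for k < 4, to k + 1/2, where
  the factorial formula applies. The four linear factors are those of
  \<open>bessel_coeff (2 * k)\<close>.\<close>

lemma rGamma_nat_minus_seven_halves:
  "rGamma (real k - 7/2) =
    (2 * real k - 1) * (2 * real k - 3) * (2 * real k - 5) * (2 * real k - 7) / 16 * rGamma (real k + 1/2)"
  using pochhammer_rGamma[of "real k - 7/2" 4]
  by (simp add: pochhammer_Suc eval_nat_numeral field_simps)

lemma bessel_I_minus_nine_halves:
  assumes "z > 0"
  shows "bessel_I (- (9/2)) z
    = sqrt (2 / pi) * z powr (- (9/2)) * ((bessel_exp z + bessel_exp (- z)) / 2)"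
proof -
  let ?f = "\<lambda>n. bessel_coeff n * (z ^ n + (- z) ^ n) / 2"
  have "?f sums ((bessel_exp z + bessel_exp (- z)) / 2)"
    using sums_divide[OF sums_add[OF bessel_exp_sums[of z] bessel_exp_sums[of "- z"]], of 2]
    by (simp add: algebra_simps)
  \<comment> \<open>Odd powers cancel between z and -z, so the sum can be reindexed over n =
    2k.\<close>
  moreover have "?f n = 0" if "n \<notin> range (\<lambda>k. 2 * k)" for n
  proof -
    have "odd n" using that by (auto elim: evenE)
    then show ?thesis by simp
  qed
  moreover have "strict_mono (\<lambda>k::nat. 2 * k)"
    by (simp add: strict_mono_def)
  ultimately have "(\<lambda>k. ?f (2 * k)) sums ((bessel_exp z + bessel_exp (- z)) / 2)"
    using sums_mono_reindex[of "\<lambda>k. 2 * k" ?f] by blast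
  then have "(\<lambda>k. sqrt (2 / pi) * z powr (- (9/2)) * ?f (2 * k)) sums
    (sqrt (2 / pi) * z powr (- (9/2)) * ((bessel_exp z + bessel_exp (- z)) / 2))"
    by (rule sums_mult)
  moreover have "sqrt (2 / pi) * z powr (- (9/2)) * ?f (2 * k)
      = (z / 2) powr (- (9/2) + 2 * real k) * rGamma (- (9/2) + real k + 1) / fact k" for k
  proof -
    \<comment> \<open>The factor 16 sqrt 2 comes from 2^(9/2); its 16 cancels the denominator in
      \<open>rGamma_nat_minus_seven_halves\<close>.\<close>
    have p: "(z / 2) powr (- (9/2) + 2 * real k) = z powr (- (9/2)) * z ^ (2 * k) * (16 * sqrt 2 / 4 ^ k)"
    proof -
      have "(z / 2) powr (- (9/2) + 2 * real k) = z powr (- (9/2) + real (2 * k)) / 2 powr (- (9/2) + real (2 * k))"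
        using assms by (simp add: powr_divide)
      also have "z powr (- (9/2) + real (2 * k)) = z powr (- (9/2)) * z ^ (2 * k)"
        using assms by (simp only: powr_add powr_realpow)
      also have "2 powr (- (9/2) + real (2 * k)) = (2 powr (-5) * 2 powr (1/2) * 2 powr real (2 * k) :: real)"
        by (subst powr_add[symmetric])+ simp
      also have "2 powr real (2 * k) = (4 ^ k :: real)"
        by (simp only: powr_realpow zero_less_numeral power_mult) simp
      also have "2 powr (-5) * 2 powr (1/2) * 4 ^ k = 4 ^ k / (16 * sqrt (2::real))"
        by (simp add: powr_half_sqrt powr_minus field_simps)
      finally show ?thesis by simp
    qed
    have g: "rGamma (- (9/2) + real k + 1) = rGamma (real k - 7/2)"
      by (rule arg_cong[of _ _ rGamma]) simp
    show ?thesis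
      unfolding p g rGamma_nat_minus_seven_halves rGamma_nat_plus_half bessel_coeff_def
      by (simp add: real_sqrt_divide divide_simps)
  qed
  ultimately show ?thesis
    unfolding bessel_I_def by (simp add: sums_iff)
qed

lemma bessel_I_nine_halves:
  assumes "z > 0"
  shows "bessel_I (9/2) z
    = sqrt (2 / pi) * z powr (- (9/2)) * ((bessel_exp z - bessel_exp (- z)) / 2)"
proof -
  let ?f = "\<lambda>n. bessel_coeff n * (z ^ n - (- z) ^ n) / 2"
  have "?f sums ((bessel_exp z - bessel_exp (- z)) / 2)"
    using sums_divide[OF sums_diff[OF bessel_exp_sums[of z] bessel_exp_sums[of "- z"]], of 2]
    by (simp add: algebra_simps)
  \<comment> \<open>Even powers cancel, and the odd n below 9 are the roots 1, 3, 5, 7 of the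
    numerator of \<open>bessel_coeff\<close>. The offset 9 is what turns z^(-9/2) into the leading
    power z^(9/2).\<close>
  moreover have "?f n = 0" if "n \<notin> range (\<lambda>k. 2 * k + 9)" for n
  proof (cases "even n")
    case False
    then obtain j where j: "n = 2 * j + 1" by (auto elim: oddE)
    have "j < 4"
    proof (rule ccontr)
      assume "\<not> j < 4"
      then have "n = 2 * (j - 4) + 9" using j by simp
      with that show False by blast
    qed
    then have "j = 0 \<or> j = 1 \<or> j = 2 \<or> j = 3" by linarith
    then show ?thesis
      using j by (auto simp: bessel_coeff_def)
  qed simp
  moreover have "strict_mono (\<lambda>k::nat. 2 * k + 9)"
    by (simp add: strict_mono_def)
  ultimately have "(\<lambda>k. ?f (2 * k + 9)) sums ((bessel_exp z - bessel_exp (- z)) / 2)"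
    using sums_mono_reindex[of "\<lambda>k. 2 * k + 9" ?f] by blast
  then have "(\<lambda>k. sqrt (2 / pi) * z powr (- (9/2)) * ?f (2 * k + 9)) sums
    (sqrt (2 / pi) * z powr (- (9/2)) * ((bessel_exp z - bessel_exp (- z)) / 2))"
    by (rule sums_mult)
  moreover have "sqrt (2 / pi) * z powr (- (9/2)) * ?f (2 * k + 9)
      = (z / 2) powr (9/2 + 2 * real k) * rGamma (9/2 + real k + 1) / fact k" for k
  proof -
    define u where "u = real k"
    have p: "(z / 2) powr (9/2 + 2 * real k) = z powr (- (9/2)) * z ^ (2 * k + 9) * (sqrt 2 / (32 * 4 ^ k))"
    proof -
      have "(z / 2) powr (9/2 + 2 * real k) = z powr (- (9/2) + real (2 * k + 9)) / 2 powr (9/2 + real (2 * k))"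
        using assms by (simp add: powr_divide)
      also have "z powr (- (9/2) + real (2 * k + 9)) = z powr (- (9/2)) * z ^ (2 * k + 9)"
        using assms by (simp only: powr_add powr_realpow)
      also have "2 powr (9/2 + real (2 * k)) = (2 powr 4 * 2 powr (1/2) * 2 powr real (2 * k) :: real)"
        by (subst powr_add[symmetric])+ simp
      also have "2 powr real (2 * k) = (4 ^ k :: real)"
        by (simp only: powr_realpow zero_less_numeral power_mult) simp
      also have "2 powr 4 * 2 powr (1/2) * 4 ^ k = 32 * 4 ^ k / sqrt (2::real)"
        by (simp add: powr_half_sqrt field_simps)
      finally show ?thesis by simp
    qed
    have g: "rGamma (9/2 + real k + 1) = rGamma (real (k + 5) + 1/2)"
      by (rule arg_cong[of _ _ rGamma]) simp
    \<comment> \<open>The half-integer formula at m = k + 5 brings in (k+5)! and (2k+10)!. They are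
      reduced to k! and (2k+9)!, the factorials in the Bessel series and in
      \<open>bessel_coeff\<close>; then 32 (u+1)...(u+5) = (2u+2)(2u+4)...(2u+10), and 2u+10
      cancels.\<close>
    have f1: "fact (k + 5) = (u + 5) * (u + 4) * (u + 3) * (u + 2) * (u + 1) * (fact k :: real)"
      unfolding u_def by (simp add: eval_nat_numeral algebra_simps)
    have f2: "fact (2 * (k + 5)) = (2 * u + 10) * (fact (2 * k + 9) :: real)"
    proof -
      have "2 * (k + 5) = Suc (2 * k + 9)" by simp
      then show ?thesis
        unfolding u_def by (simp only: fact_Suc) simp
    qed
    have c: "bessel_coeff (2 * k + 9) = (2*u+8) * (2*u+6) * (2*u+4) * (2*u+2) / fact (2 * k + 9)"
      unfolding bessel_coeff_def u_def by (simp add: add_ac)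
    have u: "u \<ge> 0" by (simp add: u_def)
    have "2 * u + 10 \<noteq> 0" using u by simp
    moreover have "(- z) ^ (2 * k + 9) = - (z ^ (2 * k + 9))"
      by (simp add: power_minus_odd)
    ultimately show ?thesis
      unfolding p g rGamma_nat_plus_half f1 f2 c
      using assms by (simp add: real_sqrt_divide power_add divide_simps) algebra
  qed
  ultimately show ?thesis
    unfolding bessel_I_def by (simp add: sums_iff)
qed

section \<open>Closed form of the Macdonald function of order 9/2\<close>

lemma sin_nine_halves_pi: "sin (9/2 * pi) = 1"
proof -
  have "sin (9/2 * pi) = sin (pi/2 + 2 * pi + 2 * pi)"
    by (rule arg_cong[of _ _ sin]) simp
  then show ?thesis by (simp only: sin_periodic sin_pi_half)
qed

lemma nine_halves_not_Ints: "(9/2 :: real) \<notin> \<int>"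
  using fraction_not_in_Ints[of 2 9, where 'a = real] by simp

text \<open>Since 9/2 is not an integer, the quotient in the definition applies, with denominator 1.
  The even part of G minus its odd part at z is G(-z).\<close>

lemma macdonald_K_nine_halves:
  assumes "z > 0"
  shows "macdonald_K (9/2) z = sqrt (pi / 2) * z powr (- (9/2)) * bessel_exp (- z)"
proof -
  have "pi / 2 * sqrt (2 / pi) = sqrt (pi / 2)"
    by (simp add: real_sqrt_divide field_simps)
  moreover have "macdonald_K (9/2) z = pi / 2 * sqrt (2 / pi) * z powr (- (9/2)) * bessel_exp (- z)"
    unfolding macdonald_K_def
    unfolding Let_def sin_nine_halves_pi bessel_I_minus_nine_halves[OF assms] bessel_I_nine_halves[OF assms]
    using nine_halves_not_Ints by (simp add: diff_divide_distrib add_divide_distrib algebra_simps)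
  ultimately show ?thesis by simp
qed

section \<open>Derivatives of erf, W and E\<close>

lemma erf_has_real_derivative: "(erf has_real_derivative 2 / sqrt pi * exp (- (z\<^sup>2))) (at z)"
proof -
  \<comment> \<open>The interval contains the base point 0 and has z in its interior, so the
    derivative within it is two-sided, for either sign of z.\<close>
  define l where "l = min 0 z - 1"
  define r where "r = max 0 z + 1"
  have "((\<lambda>u. LBINT t=0..u. exp (- (t\<^sup>2))) has_vector_derivative exp (- (z\<^sup>2))) (at z within {l..r})"
    unfolding zero_ereal_def
    by (rule interval_integral_FTC2) (auto simp: l_def r_def intro!: continuous_intros)
  moreover have "z \<in> interior {l..r}"
    by (auto simp: l_def r_def interior_atLeastAtMost_real)
  ultimately have "((\<lambda>u. LBINT t=0..u. exp (- (t\<^sup>2))) has_real_derivative exp (- (z\<^sup>2))) (at z)"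
    unfolding has_real_derivative_iff_has_vector_derivative by (simp only: at_within_interior)
  then show ?thesis
    unfolding erf_def [abs_def] by (rule DERIV_cmult)
qed

text \<open>Completing the square gives (2ax+b)^2/(4a) = ax^2 + bx + b^2/(4a); the prefactor of W
  removes the constant, and the inner function has slope sqrt a.\<close>

lemma W_fun_has_real_derivative:
  assumes "a > 0"
  shows "(W_fun a b has_real_derivative 2 * sqrt a * E_fun a b x) (at x)"
proof -
  have "((\<lambda>x. (2 * a * x + b) / (2 * sqrt a)) has_real_derivative sqrt a) (at x)"
    using assms by (auto intro!: derivative_eq_intros simp: field_simps)
  from DERIV_cmult[OF DERIV_chain2[OF erf_has_real_derivative this], of "sqrt pi * exp (b\<^sup>2 / (4 * a))"]
  have "(W_fun a b has_real_derivative sqrt pi * exp (b\<^sup>2 / (4 * a)) *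
      (2 / sqrt pi * exp (- (((2 * a * x + b) / (2 * sqrt a))\<^sup>2)) * sqrt a)) (at x)"
    unfolding W_fun_def [abs_def] .
  moreover have "E_fun a b x = exp (b\<^sup>2 / (4 * a)) * exp (- (((2 * a * x + b) / (2 * sqrt a))\<^sup>2))"
  proof -
    have "((2 * a * x + b) / (2 * sqrt a))\<^sup>2 = (2 * a * x + b)\<^sup>2 / (4 * a)"
      using assms by (simp add: power_divide power_mult_distrib)
    also have "\<dots> = a * x\<^sup>2 + b * x + b\<^sup>2 / (4 * a)"
      using assms by (simp add: field_simps power2_eq_square)
    finally show ?thesis
      unfolding E_fun_def exp_add[symmetric] by simp
  qed
  ultimately show ?thesis
    by (simp add: field_simps)
qed

lemma E_fun_has_real_derivative:
  "(E_fun a b has_real_derivative - (2 * a * x + b) * E_fun a b x) (at x)"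
  unfolding E_fun_def [abs_def] by (auto intro!: derivative_eq_intros)

section \<open>The Bessel integrand in elementary form\<close>

text \<open>Without b in the denominators, the later identities become polynomial identities modulo
  x * y = 1, where y stands for \<open>inverse x\<close>.\<close>

lemma P_fun_inverse:
  assumes "b > 0" "x > 0"
  shows "b^4 * P_fun b x
    = 105 * inverse x ^ 4 + 105 * b * inverse x ^ 3 + 45 * b^2 * inverse x ^ 2 + 10 * b^3 * inverse x + b^4"
proof -
  have "b^4 * (105 / (b^4 * x^4)) = 105 * inverse x ^ 4"
    and "b^4 * (105 / (b^3 * x^3)) = 105 * b * inverse x ^ 3"
    and "b^4 * (45 / (b^2 * x^2)) = 45 * b^2 * inverse x ^ 2"
    and "b^4 * (10 / (b * x)) = 10 * b^3 * inverse x"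
    using assms by (simp_all add: field_simps flip: power_add power_Suc power_Suc2)
  then show ?thesis
    unfolding P_fun_def distrib_left by simp
qed

text \<open>The powers b^(9/2) and b^(-9/2) cancel, those of x combine to x^(p-4), and (bx)^4 P(x)
  is the polynomial factor of G(-bx), which makes up for the missing x^4 and yields b^4.\<close>

lemma bessel_integrand_eq:
  assumes "b > 0" "x > 0"
  shows "sqrt (2 / pi) *
       (exp (- a * x\<^sup>2) * b powr (4 + 1 / 2) * x powr (real_of_int p + 1 / 2) * macdonald_K (9 / 2) (b * x))
     = b^4 * (x powi p * P_fun b x * E_fun a b x)"
proof -
  have "sqrt (2 / pi) * sqrt (pi / 2) = 1"
    by (simp add: real_sqrt_divide)
  moreover have "b powr (4 + 1/2) * x powr (real_of_int p + 1/2) * (b * x) powr (- (9/2)) = x powi p / x ^ 4"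
  proof -
    \<comment> \<open>Writing \<open>real 4\<close> lets \<open>powr_realpow\<close> produce a
      natural power.\<close>
    have "x powr (real_of_int p + 1/2) * x powr (- (9/2)) = x powr (real_of_int p - real 4)"
      by (simp add: powr_add[symmetric])
    also have "\<dots> = x powi p / x ^ 4"
      using assms by (simp only: powr_diff powr_realpow) (simp add: powr_real_of_int')
    finally have "x powr (real_of_int p + 1/2) * x powr (- (9/2)) = x powi p / x ^ 4" .
    moreover have "b powr (4 + 1/2) * b powr (- (9/2)) = 1"
      using assms by (simp add: powr_add[symmetric])
    moreover have "b powr (4 + 1/2) * x powr (real_of_int p + 1/2) * (b * x) powr (- (9/2))
        = (x powr (real_of_int p + 1/2) * x powr (- (9/2))) * (b powr (4 + 1/2) * b powr (- (9/2)))"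
      using assms by (simp add: powr_mult)
    ultimately show ?thesis
      by simp
  qed
  moreover have "exp (- a * x\<^sup>2) * bessel_exp (- (b * x)) = E_fun a b x * ((b * x) ^ 4 * P_fun b x)"
  proof -
    have "(b * x) ^ 4 * P_fun b x
        = b ^ 4 * P_fun b x * x ^ 4"
      by (simp add: power_mult_distrib)
    also have "\<dots> = 105 + 105 * (b * x) + 45 * (b * x)^2 + 10 * (b * x)^3 + (b * x)^4"
    proof -
      define y where "y = inverse x"
      have "x * y = 1" using assms(2) by (simp add: y_def)
      then show ?thesis
        unfolding P_fun_inverse[OF assms] y_def[symmetric] by algebra
    qed
    finally show ?thesis
      unfolding bessel_exp_def E_fun_def by (simp add: exp_diff exp_minus divide_inverse)
  qed
  ultimately have "(sqrt (2 / pi) * sqrt (pi / 2)) *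
      (b powr (4 + 1/2) * x powr (real_of_int p + 1/2) * (b * x) powr (- (9/2))) *
      (exp (- a * x\<^sup>2) * bessel_exp (- (b * x)))
    = x powi p / x ^ 4 * (E_fun a b x * ((b * x) ^ 4 * P_fun b x))"
    by simp
  also have "\<dots> = b^4 * (x powi p * P_fun b x * E_fun a b x)"
    using assms by (simp add: power_mult_distrib)
  finally show ?thesis
    using assms by (simp add: macdonald_K_nine_halves mult_ac)
qed

section \<open>The four antiderivatives\<close>

text \<open>Each V has the form E R + c W with R rational. Every term of the derivative contains E,
  so each case reduces to an identity of rational functions; k absorbs the factor sqrt a.\<close>

lemma E_fun_W_fun_has_real_derivative:
  assumes "a > 0" "(R has_real_derivative R') (at x)"
    and "2 * sqrt a * c = k"
    and "R' - (2 * a * x + b) * R x + k = f"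
  shows "((\<lambda>x. E_fun a b x * R x + c * W_fun a b x) has_real_derivative E_fun a b x * f) (at x)"
proof -
  have "((\<lambda>x. E_fun a b x * R x + c * W_fun a b x) has_real_derivative
      - (2 * a * x + b) * E_fun a b x * R x + R' * E_fun a b x + c * (2 * sqrt a * E_fun a b x)) (at x)"
    by (rule DERIV_add[OF DERIV_mult[OF E_fun_has_real_derivative assms(2)]
      DERIV_cmult[OF W_fun_has_real_derivative[OF assms(1)]]])
  moreover have "- (2 * a * x + b) * E_fun a b x * R x + R' * E_fun a b x + c * (2 * sqrt a * E_fun a b x)
    = E_fun a b x * f"
    unfolding assms(3,4)[symmetric] by (simp add: algebra_simps)
  ultimately show ?thesis by simp
qed

lemma powr_half_integer:
  assumes "a > (0::real)"
  shows "a powr (3/2) = a * sqrt a" "a powr (5/2) = a^2 * sqrt a" "a powr (7/2) = a^3 * sqrt a"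
proof -
  have "a powr (real n + 1/2) = a ^ n * sqrt a" for n
    using assms by (simp only: powr_add powr_realpow) (simp add: powr_half_sqrt)
  from this[of 1] this[of 2] this[of 3]
  show "a powr (3/2) = a * sqrt a" "a powr (5/2) = a^2 * sqrt a" "a powr (7/2) = a^3 * sqrt a"
    by simp_all
qed

lemma V_2_has_real_derivative:
  assumes "a > 0" "b > 0" "x > 0"
  shows "(V_2 a b has_real_derivative b^4 * (x^2 * P_fun b x * E_fun a b x)) (at x)"
proof -
  define y where "y = inverse x"
  have xy: "x * y = 1"
    using assms(3) by (simp add: y_def)
  \<comment> \<open>In this case R has denominators in a. They are hidden in k0, k1 and k; the
    relations \<open>coeffs\<close> match the coefficients of x^2, x and 1 in b^4 x^2 P(x).\<close>
  define k0 where "k0 = (20 * a * b^3 - b^5) / (4 * a^2)"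
  define k1 where "k1 = b^4 / (2 * a)"
  define k where "k = - (840 * a^3 - 180 * a^2 * b^2 + 18 * a * b^4 - b^6) / (4 * a^2)"
  have coeffs: "2 * a * k1 = b^4" "2 * a * k0 + b * k1 = 10 * b^3"
      "b * k0 - k1 + 210 * a + k = 45 * b^2"
  proof -
    show "2 * a * k1 = b^4"
      unfolding k1_def using assms(1) by simp
    show "2 * a * k0 + b * k1 = 10 * b^3"
      unfolding k0_def k1_def using assms(1) by (simp add: divide_simps) algebra
    show "b * k0 - k1 + 210 * a + k = 45 * b^2"
      unfolding k0_def k1_def k_def using assms(1) by (simp add: divide_simps) algebra
  qed
  define R where "R = (\<lambda>x. - (k0 + k1 * x + 105 * inverse x))"
  define c where "c = - ((840 * a^3 - 180 * a^2 * b^2 + 18 * a * b^4 - b^6) / (8 * a powr (5/2)))"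
  have "V_2 a b = (\<lambda>x. E_fun a b x * R x + c * W_fun a b x)"
    unfolding V_2_def [abs_def] R_def k0_def k1_def c_def
    by (simp add: inverse_eq_divide del: minus_add_distrib)
  moreover have "((\<lambda>x. E_fun a b x * R x + c * W_fun a b x) has_real_derivative
      E_fun a b x * (b^4 * P_fun b x * x^2)) (at x)"
  proof (rule E_fun_W_fun_has_real_derivative[OF assms(1)])
    \<comment> \<open>Removing \<open>power_inverse\<close> keeps powers of \<open>inverse x\<close>
      as powers of a single atom for \<open>algebra\<close>.\<close>
    show "(R has_real_derivative - (k1 - 105 * y ^ 2)) (at x)"
      unfolding R_def y_def using assms
      by (auto intro!: derivative_eq_intros simp del: power_inverse) algebra
    show "2 * sqrt a * c = k"
      unfolding c_def k_def powr_half_integer[OF assms(1)] using assms by (simp add: divide_simps)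
    have "b^4 * P_fun b x * x^2 = 105 * y^2 + 105 * b * y + 45 * b^2 + 10 * b^3 * x + b^4 * x^2"
      unfolding P_fun_inverse[OF assms(2,3)] y_def[symmetric] using xy by algebra
    also have "\<dots> = 105 * y^2 + 105 * b * y + (b * k0 - k1 + 210 * a + k)
        + (2 * a * k0 + b * k1) * x + (2 * a * k1) * x^2"
      unfolding coeffs ..
    also have "\<dots> = - (k1 - 105 * y ^ 2) - (2 * a * x + b) * R x + k"
      unfolding R_def y_def[symmetric] using xy by algebra
    finally show "- (k1 - 105 * y ^ 2) - (2 * a * x + b) * R x + k = b^4 * P_fun b x * x^2" ..
  qed
  ultimately show ?thesis by (simp add: mult_ac)
qed

lemma V_0_has_real_derivative:
  assumes "a > 0" "b > 0" "x > 0"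
  shows "(V_0 a b has_real_derivative b^4 * (P_fun b x * E_fun a b x)) (at x)"
proof -
  define y where "y = inverse x"
  have xy: "x * y = 1"
    using assms(3) by (simp add: y_def)
  define R where "R = (\<lambda>x. - (5 * (2 * b^2 - 14 * a) * inverse x + 35 * b * inverse x ^ 2 + 35 * inverse x ^ 3))"
  define c where "c = (140 * a^2 - 20 * a * b^2 + b^4) / (2 * sqrt a)"
  have "V_0 a b = (\<lambda>x. E_fun a b x * R x + c * W_fun a b x)"
    unfolding V_0_def [abs_def] R_def c_def divide_inverse power_inverse
    by (simp add: mult_ac del: minus_add_distrib)
  moreover have "((\<lambda>x. E_fun a b x * R x + c * W_fun a b x) has_real_derivative
      E_fun a b x * (b^4 * P_fun b x)) (at x)"
  proof (rule E_fun_W_fun_has_real_derivative[OF assms(1)])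
    show "(R has_real_derivative 5 * (2 * b^2 - 14 * a) * y ^ 2 + 70 * b * y ^ 3 + 105 * y ^ 4) (at x)"
      unfolding R_def y_def using assms
      by (auto intro!: derivative_eq_intros simp del: power_inverse) algebra
    \<comment> \<open>The product of 2ax with the 1/x term of R contributes 20ab^2 - 140a^2; adding
      this k leaves exactly the constant term b^4 of b^4 P(x).\<close>
    show "2 * sqrt a * c = 140 * a^2 - 20 * a * b^2 + b^4"
      unfolding c_def using assms by simp
    show "5 * (2 * b^2 - 14 * a) * y ^ 2 + 70 * b * y ^ 3 + 105 * y ^ 4 - (2 * a * x + b) * R x
        + (140 * a^2 - 20 * a * b^2 + b^4) = b^4 * P_fun b x"
      unfolding R_def P_fun_inverse[OF assms(2,3)] y_def[symmetric] using xy by algebra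
  qed
  ultimately show ?thesis unfolding y_def divide_inverse power_inverse
    by (simp add: mult_ac)
qed

lemma V_minus2_has_real_derivative:
  assumes "a > 0" "b > 0" "x > 0"
  shows "(V_minus2 a b has_real_derivative b^4 * (P_fun b x / x^2 * E_fun a b x)) (at x)"
proof -
  define y where "y = inverse x"
  have xy: "x * y = 1"
    using assms(3) by (simp add: y_def)
  define R where "R = (\<lambda>x. (2 * a * b^2 - 28 * a^2) * inverse x + (14 * a * b - b^3) * inverse x ^ 2
       + (14 * a - 8 * b^2) * inverse x ^ 3 - 21 * b * inverse x ^ 4 - 21 * inverse x ^ 5)"
  define c where "c = - 2 * a powr (3/2) * (14 * a - b^2)"
  have "V_minus2 a b = (\<lambda>x. E_fun a b x * R x + c * W_fun a b x)"
    unfolding V_minus2_def [abs_def] R_def c_def divide_inverse power_inverse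
    by (simp add: mult_ac del: minus_add_distrib)
  moreover have "((\<lambda>x. E_fun a b x * R x + c * W_fun a b x) has_real_derivative
      E_fun a b x * (b^4 * P_fun b x * y ^ 2)) (at x)"
  proof (rule E_fun_W_fun_has_real_derivative[OF assms(1)])
    show "(R has_real_derivative - (2 * a * b^2 - 28 * a^2) * y ^ 2 - 2 * (14 * a * b - b^3) * y ^ 3
       - 3 * (14 * a - 8 * b^2) * y ^ 4 + 84 * b * y ^ 5 + 105 * y ^ 6) (at x)"
      unfolding R_def y_def using assms
      by (auto intro!: derivative_eq_intros simp del: power_inverse) algebra
    \<comment> \<open>The target begins at y^2, so k has to cancel the whole constant term -2a(2ab^2
      - 28a^2) coming from R.\<close>
    show "2 * sqrt a * c = - 4 * a^2 * (14 * a - b^2)"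
      unfolding c_def powr_half_integer[OF assms(1)] using assms by (simp add: power2_eq_square)
    show "- (2 * a * b^2 - 28 * a^2) * y ^ 2 - 2 * (14 * a * b - b^3) * y ^ 3
       - 3 * (14 * a - 8 * b^2) * y ^ 4 + 84 * b * y ^ 5 + 105 * y ^ 6 - (2 * a * x + b) * R x
        + - 4 * a^2 * (14 * a - b^2) = b^4 * P_fun b x * y ^ 2"
      unfolding R_def P_fun_inverse[OF assms(2,3)] y_def[symmetric] using xy by algebra
  qed
  ultimately show ?thesis unfolding y_def divide_inverse power_inverse
    by (simp add: mult_ac)
qed

lemma V_minus4_has_real_derivative:
  assumes "a > 0" "b > 0" "x > 0"
  shows "(V_minus4 a b has_real_derivative b^4 * (P_fun b x / x^4 * E_fun a b x)) (at x)"
proof -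
  define y where "y = inverse x"
  have xy: "x * y = 1"
    using assms(3) by (simp add: y_def)
  define R where "R = (\<lambda>x. - 15 * inverse x ^ 7 - 15 * b * inverse x ^ 6 - 6 * (b^2 - a) * inverse x ^ 5 + (6 * a * b - b^3) * inverse x ^ 4
       + 2 * (a * b^2 - 2 * a^2) * inverse x ^ 3 - 4 * a^2 * b * inverse x ^ 2 + 8 * a^3 * inverse x)"
  define c where "c = 8 * a powr (7/2)"
  have "V_minus4 a b = (\<lambda>x. E_fun a b x * R x + c * W_fun a b x)"
    unfolding V_minus4_def [abs_def] R_def c_def divide_inverse power_inverse
    by (simp add: mult_ac del: minus_add_distrib)
  moreover have "((\<lambda>x. E_fun a b x * R x + c * W_fun a b x) has_real_derivative
      E_fun a b x * (b^4 * P_fun b x * y ^ 4)) (at x)"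
  proof (rule E_fun_W_fun_has_real_derivative[OF assms(1)])
    show "(R has_real_derivative 105 * y ^ 8 + 90 * b * y ^ 7 + 30 * (b^2 - a) * y ^ 6
       - 4 * (6 * a * b - b^3) * y ^ 5 - 6 * (a * b^2 - 2 * a^2) * y ^ 4 + 8 * a^2 * b * y ^ 3 - 8 * a^3 * y ^ 2) (at x)"
      unfolding R_def y_def using assms
      by (auto intro!: derivative_eq_intros simp del: power_inverse) algebra
    \<comment> \<open>Again k cancels the constant term, here -2a * 8a^3.\<close>
    show "2 * sqrt a * c = 16 * a^4"
      unfolding c_def powr_half_integer[OF assms(1)] using assms by (simp add: eval_nat_numeral)
    show "105 * y ^ 8 + 90 * b * y ^ 7 + 30 * (b^2 - a) * y ^ 6
       - 4 * (6 * a * b - b^3) * y ^ 5 - 6 * (a * b^2 - 2 * a^2) * y ^ 4 + 8 * a^2 * b * y ^ 3 - 8 * a^3 * y ^ 2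
       - (2 * a * x + b) * R x + 16 * a^4 = b^4 * P_fun b x * y ^ 4"
      unfolding R_def P_fun_inverse[OF assms(2,3)] y_def[symmetric] using xy by algebra
  qed
  ultimately show ?thesis unfolding y_def divide_inverse power_inverse
    by (simp add: mult_ac)
qed

theorem mainTheorem5:
  fixes a b :: real and p :: int and V :: "real \<Rightarrow> real"
  assumes "a > 0" and "b > 0"
    and "(p, V) \<in> {(2, V_2 a b), (0, V_0 a b), (-2, V_minus2 a b), (-4, V_minus4 a b)}"
  shows "integral_identity
    (\<lambda>x. sqrt (2 / pi) *
       (exp (- a * x\<^sup>2) * b powr (4 + 1 / 2) * x powr (real_of_int p + 1 / 2) * macdonald_K (9 / 2) (b * x)))
    (\<lambda>x. b^4 * (x powi p * P_fun b x * E_fun a b x))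
    V"
  unfolding integral_identity_def
proof (intro conjI allI impI)
  fix x :: real
  assume x: "x > 0"
  show eq: "sqrt (2 / pi) *
       (exp (- a * x\<^sup>2) * b powr (4 + 1 / 2) * x powr (real_of_int p + 1 / 2) * macdonald_K (9 / 2) (b * x))
     = b^4 * (x powi p * P_fun b x * E_fun a b x)"
    using assms(2) x by (rule bessel_integrand_eq)
  \<comment> \<open>The membership assumption splits into the four pairs; for negative p,
    \<open>power_int_minus\<close> turns \<open>x powi p\<close> into the division by x^2 or
    x^4.\<close>
  have "(V has_real_derivative b^4 * (x powi p * P_fun b x * E_fun a b x)) (at x)"
    using assms(3) V_2_has_real_derivative[OF assms(1,2) x] V_0_has_real_derivative[OF assms(1,2) x]
      V_minus2_has_real_derivative[OF assms(1,2) x] V_minus4_has_real_derivative[OF assms(1,2) x]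
    by (auto simp: power_int_minus divide_inverse mult_ac)
  then show "(V has_real_derivative sqrt (2 / pi) *
       (exp (- a * x\<^sup>2) * b powr (4 + 1 / 2) * x powr (real_of_int p + 1 / 2) * macdonald_K (9 / 2) (b * x))) (at x)"
    unfolding eq .
qed

end
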